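(* Assume that the chain $\Phi$ with transition kernel $P$ on $(X,\mathcal{B}(X))$ is $\psi$-irreducible, and that $\mathbb{P}_x\{\tau<\infty\}=1$ for all $x\in X$, where $\tau=\sup\{n\geq0:\Phi_n\in X\}$. Then the following statements are equivalent. (1) The chain is uniformly geometric transient. (2) There exists a constant $\kappa>1$ such that $\sup_{x\in X}\mathbb{E}_x[\kappa^{\tau}]<\infty$. (3) There exist a constant $\lambda\in(0,1)$ and a bounded measurable function $W\geq1$ on $X$ such that $PW(x)\leq\lambda W(x)$ for all $x\in X$. (4) There exists some $n_0\in\mathbb{N}=\{1,2,\dots\}$ such that $\sup_{x\in X}P^{n_0}(x,X)<1$. (5) $\sup_{x\in X}\mathbb{E}_x\tau<\infty$.
   Context: Setting: $\Phi=\{\Phi_n:n\in\mathbb{Z}_+\}$ is a discrete-time homogeneous Markov chain on a general state space $X$ with a countably generated $\sigma$-field $\mathcal{B}(X)$. $P^n(x,A)=\mathbb{P}_x\{\Phi_n\in A\}$ is its $n$-step transition kernel; $P$ may be sub-stochastic, in which case the chain may leave $X$ (be killed), after which it never returns; thus $\tau=\sup\{n\ge0:\Phi_n\in X\}$ is the last time the chain is in $X$. $\mathbb{P}_x,\mathbb{E}_x$ refer to $\Phi_0=x$. For measurable $f\ge 0$, $P^nf(x)=\int_X f(y)P^n(x,dy)$. Irreducibility: $\Phi$ is $\psi$-irreducible, where $\psi$ is a maximal irreducibility measure: $\psi$ is a nontrivial $\sigma$-finite measure such that $\psi(A)>0$ implies that for every $x\in X$ there is $n\ge1$ with $P^n(x,A)>0$,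 and every other measure with this property is absolutely continuous with respect to $\psi$. The chain $\Phi$ is called uniformly geometric transient if there exists a constant $\kappa>1$ such that $\sup_{x\in X}\sum_{n=1}^{\infty}\kappa^{n}P^{n}(x,X)<\infty$. *)

theory Defs
  imports "HOL-Probability.Probability"
begin

text \<open>The state space is a measure \<open>M\<close> of which only the underlying measurable space
  \<open>(space M, sets M)\<close> matters. A sub-stochastic kernel on it is an element \<open>P\<close> of
  \<open>M \<rightarrow>\<^sub>M subprob_algebra M\<close>.\<close>

definition countably_generated :: "'a measure \<Rightarrow> bool" where
  "countably_generated M \<longleftrightarrow>
     (\<exists>G. countable G \<and> G \<subseteq> Pow (space M) \<and> sets M = sigma_sets (space M) G)"

primrec kernel_pow :: "'a measure \<Rightarrow> ('a \<Rightarrow> 'a measure) \<Rightarrow> nat \<Rightarrow> 'a \<Rightarrow> 'a measure" where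
  "kernel_pow M P 0 x = return M x"
| "kernel_pow M P (Suc n) x = P x \<bind> kernel_pow M P n"

definition irreducibility_measure :: "'a measure \<Rightarrow> ('a \<Rightarrow> 'a measure) \<Rightarrow> 'a measure \<Rightarrow> bool" where
  "irreducibility_measure M P \<phi> \<longleftrightarrow>
     sets \<phi> = sets M \<and> sigma_finite_measure \<phi> \<and> emeasure \<phi> (space M) \<noteq> 0 \<and>
     (\<forall>A\<in>sets M. emeasure \<phi> A > 0 \<longrightarrow>
        (\<forall>x\<in>space M. \<exists>n\<ge>1. emeasure (kernel_pow M P n x) A > 0))"

definition maximal_irreducibility_measure ::
    "'a measure \<Rightarrow> ('a \<Rightarrow> 'a measure) \<Rightarrow> 'a measure \<Rightarrow> bool" where
  "maximal_irreducibility_measure M P \<psi> \<longleftrightarrow>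
     irreducibility_measure M P \<psi> \<and>
     (\<forall>\<phi>. irreducibility_measure M P \<phi> \<longrightarrow> absolutely_continuous \<psi> \<phi>)"

text \<open>The state space with a cemetery \<open>None\<close> adjoined; a chain that has left the state space
  sits in \<open>None\<close>.\<close>

definition with_cemetery :: "'a measure \<Rightarrow> 'a option measure" where
  "with_cemetery M =
     sigma (insert None (Some ` space M)) (insert {None} ((\<lambda>A. Some ` A) ` sets M))"

text \<open>The \<open>\<sigma>\<close>-field generated by \<open>\<Phi> 0, \<dots>, \<Phi> n\<close>.\<close>

definition history ::
    "'a measure \<Rightarrow> 'w measure \<Rightarrow> (nat \<Rightarrow> 'w \<Rightarrow> 'a option) \<Rightarrow> nat \<Rightarrow> 'w set set" where
  "history M \<Omega> \<Phi> n =
     sigma_sets (space \<Omega>) (\<Union>k\<le>n. {\<Phi> k -` A \<inter> space \<Omega> | A. A \<in> sets (with_cemetery M)})"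

text \<open>\<open>Pr x\<close> is the law under which \<open>\<Phi>\<close> starts in \<open>x\<close>. The initial condition is stated through the
  distribution of \<open>\<Phi> 0\<close> because singletons need not be measurable. The last assumption is the
  Markov property: \<open>P (\<Phi> n) A\<close> is a version of the conditional probability of
  \<open>\<Phi> (Suc n) \<in> A\<close> given \<open>\<Phi> 0, \<dots>, \<Phi> n\<close>. The value \<open>0\<close> at \<open>None\<close> says that a killed chain
  never returns (almost surely); the mass \<open>1 - P y (space M)\<close> missing from
  \<open>P y\<close> is the probability of moving from \<open>y\<close> to \<open>None\<close>.\<close>

locale killed_markov_chain =
  fixes M :: "'a measure" and P :: "'a \<Rightarrow> 'a measure"
    and \<Omega> :: "'w measure" and Pr :: "'a \<Rightarrow> 'w measure" and \<Phi> :: "nat \<Rightarrow> 'w \<Rightarrow> 'a option"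
  assumes kernel: "P \<in> M \<rightarrow>\<^sub>M subprob_algebra M"
    and measurable_chain: "\<And>n. \<Phi> n \<in> \<Omega> \<rightarrow>\<^sub>M with_cemetery M"
    and prob_space_Pr: "\<And>x. x \<in> space M \<Longrightarrow> prob_space (Pr x)"
    and sets_Pr: "\<And>x. x \<in> space M \<Longrightarrow> sets (Pr x) = sets \<Omega>"
    and initial: "\<And>x. x \<in> space M \<Longrightarrow>
      distr (Pr x) (with_cemetery M) (\<Phi> 0) = return (with_cemetery M) (Some x)"
    and markov: "\<And>x n A B. x \<in> space M \<Longrightarrow> A \<in> sets M \<Longrightarrow> B \<in> history M \<Omega> \<Phi> n \<Longrightarrow>
      emeasure (Pr x) (B \<inter> {\<omega> \<in> space \<Omega>. \<Phi> (Suc n) \<omega> \<in> Some ` A}) =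
      (\<integral>\<^sup>+\<omega>\<in>B. (case \<Phi> n \<omega> of None \<Rightarrow> 0 | Some y \<Rightarrow> emeasure (P y) A) \<partial>Pr x)"

definition last_time :: "'a measure \<Rightarrow> (nat \<Rightarrow> 'w \<Rightarrow> 'a option) \<Rightarrow> 'w \<Rightarrow> enat" where
  "last_time M \<Phi> \<omega> = (SUP n\<in>{n. \<Phi> n \<omega> \<in> Some ` space M}. enat n)"

text \<open>The power \<open>\<kappa>\<^sup>t\<close> for \<open>\<kappa> > 1\<close>, so that the value at \<open>t = \<infinity>\<close> is \<open>\<infinity>\<close>.\<close>

definition pow_enat :: "real \<Rightarrow> enat \<Rightarrow> ennreal" where
  "pow_enat \<kappa> t = (case t of enat n \<Rightarrow> ennreal (\<kappa> ^ n) | \<infinity> \<Rightarrow> \<infinity>)"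

definition uniformly_geometric_transient :: "'a measure \<Rightarrow> ('a \<Rightarrow> 'a measure) \<Rightarrow> bool" where
  "uniformly_geometric_transient M P \<longleftrightarrow>
     (\<exists>\<kappa>>1. (SUP x\<in>space M.
        \<Sum>n. ennreal (\<kappa> ^ Suc n) * emeasure (kernel_pow M P (Suc n) x) (space M)) < \<infinity>)"

end

theory Submission
  imports Defs
begin

text \<open>
  Write \<open>u n x\<close> for \<open>P\<^sup>n(x, X)\<close>. Since a killed chain never returns, \<open>\<tau> \<ge> n\<close> holds exactly when
  \<open>\<Phi> n \<in> X\<close>, an event of probability \<open>u n x\<close>. Hence \<open>E \<tau> = (\<Sum>n. u (n + 1))\<close> and
  \<open>E \<kappa>\<^sup>\<tau> = 1 + (\<kappa> - 1) (\<Sum>n. \<kappa>\<^sup>n u (n + 1))\<close>, which makes (1) and (2) the same statement and shows that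
  (1) implies (5). As \<open>u n\<close> decreases in \<open>n\<close>, one has \<open>n u n \<le> E \<tau>\<close>, so (5) implies (4). If
  \<open>u n\<^sub>0 \<le> c < 1\<close> and \<open>\<beta> > 1\<close> satisfies \<open>\<beta>\<^bsup>n\<^sub>0\<^esup> c \<le> 1\<close>, then \<open>W = (\<Sum>k<n\<^sub>0. \<beta>\<^sup>k u k)\<close> satisfies
  \<open>P W \<le> \<beta>\<^sup>-\<^sup>1 W\<close>, so (4) implies (3). Finally, iterating \<open>P W \<le> \<lambda> W\<close> gives \<open>u n \<le> \<lambda>\<^sup>n W\<close>, and so (3)
  implies (1).
\<close>

section \<open>Survival probabilities of a sub-stochastic kernel\<close>

locale substochastic_kernel =
  fixes M :: "'a measure" and P :: "'a \<Rightarrow> 'a measure"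
  assumes measurable_kernel: "P \<in> M \<rightarrow>\<^sub>M subprob_algebra M"
begin

definition survival :: "nat \<Rightarrow> 'a \<Rightarrow> ennreal" where
  "survival n x = emeasure (kernel_pow M P n x) (space M)"

lemma sets_kernel: "x \<in> space M \<Longrightarrow> sets (P x) = sets M"
  using measurable_space[OF measurable_kernel] by (auto simp: space_subprob_algebra)

lemma space_kernel: "x \<in> space M \<Longrightarrow> space (P x) = space M"
  by (rule sets_eq_imp_space_eq) (rule sets_kernel)

lemma measurable_kernel_pow: "kernel_pow M P n \<in> M \<rightarrow>\<^sub>M subprob_algebra M"
proof (induction n)
  case 0
  have "kernel_pow M P 0 = return M" by (rule ext) simp
  then show ?case by simp
next
  case (Suc n)
  have "kernel_pow M P (Suc n) = (\<lambda>x. P x \<bind> kernel_pow M P n)" by (rule ext) simp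
  then show ?case using measurable_bind2[OF measurable_kernel Suc] by simp
qed

lemma survival_measurable [measurable]: "survival n \<in> borel_measurable M"
  using measurable_compose[OF measurable_kernel_pow measurable_emeasure_subprob_algebra[OF sets.top]]
  by (simp add: survival_def[abs_def])

lemma borel_measurable_kernel:
  "x \<in> space M \<Longrightarrow> f \<in> borel_measurable M \<Longrightarrow> f \<in> borel_measurable (P x)"
  using sets_kernel measurable_cong_sets by blast

lemma borel_measurable_kernel_integral:
  "f \<in> borel_measurable M \<Longrightarrow> (\<lambda>x. \<integral>\<^sup>+y. f y \<partial>P x) \<in> borel_measurable M"
  by (rule measurable_compose[OF measurable_kernel nn_integral_measurable_subprob_algebra])

lemma survival_0: "x \<in> space M \<Longrightarrow> survival 0 x = 1"
  by (simp add: survival_def)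

lemma survival_Suc:
  assumes "x \<in> space M"
  shows "survival (Suc n) x = (\<integral>\<^sup>+y. survival n y \<partial>P x)"
proof -
  have "kernel_pow M P n \<in> P x \<rightarrow>\<^sub>M subprob_algebra M"
    using measurable_kernel_pow sets_kernel[OF assms] measurable_cong_sets by blast
  then show ?thesis
    using assms by (auto simp: survival_def space_kernel intro!: emeasure_bind)
qed

lemma survival_le_1: "x \<in> space M \<Longrightarrow> survival n x \<le> 1"
  using measurable_space[OF measurable_kernel_pow, of x n]
  by (auto simp: survival_def space_subprob_algebra intro: subprob_space.subprob_emeasure_le_1)

text \<open>The kernel has mass at most 1, which settles \<open>n = 0\<close>; integrating the
  inequality against \<open>P x\<close> carries it from \<open>n\<close> to
  \<open>n + 1\<close>.\<close>

lemma survival_Suc_le: "x \<in> space M \<Longrightarrow> survival (Suc n) x \<le> survival n x"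
proof (induction n arbitrary: x)
  case 0
  then show ?case by (simp add: survival_0 survival_le_1)
next
  case (Suc n)
  have "(\<integral>\<^sup>+y. survival (Suc n) y \<partial>P x) \<le> (\<integral>\<^sup>+y. survival n y \<partial>P x)"
    using Suc by (intro nn_integral_mono) (auto simp: space_kernel)
  then show ?case
    using Suc.prems survival_Suc[of x n] survival_Suc[of x "Suc n"] by simp
qed

lemma survival_antimono: "x \<in> space M \<Longrightarrow> m \<le> n \<Longrightarrow> survival n x \<le> survival m x"
  by (rule lift_Suc_antimono_le[of "\<lambda>n. survival n x"]) (auto simp: survival_Suc_le)

section \<open>From a bounded survival sum to a uniform chance of being killed\<close>

text \<open>Each of the first \<open>n\<close> terms of the series is at least
  \<open>survival n x\<close>, because \<open>Suc k \<le> n\<close> for \<open>k < n\<close> and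
  survival is antitone in time.\<close>

lemma of_nat_mult_survival_le:
  assumes "x \<in> space M"
  shows "of_nat n * survival n x \<le> (\<Sum>k. survival (Suc k) x)"
proof -
  have "of_nat n * survival n x = (\<Sum>k<n. survival n x)" by simp
  also have "\<dots> \<le> (\<Sum>k<n. survival (Suc k) x)"
    using assms by (intro sum_mono survival_antimono) auto
  also have "\<dots> \<le> (\<Sum>k. survival (Suc k) x)" by (rule sum_le_suminf) auto
  finally show ?thesis .
qed

text \<open>If \<open>C\<close> bounds all the sums, then \<open>survival n x\<close> is at most
  \<open>C / n\<close> for every \<open>x\<close>, so a single \<open>n > 2 * C\<close> brings it
  below 1/2 uniformly.\<close>

lemma ex_survival_less_1:
  assumes "(SUP x\<in>space M. \<Sum>k. survival (Suc k) x) < \<infinity>"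
  shows "\<exists>n\<ge>1. (SUP x\<in>space M. survival n x) < 1"
proof -
  define C where "C = (SUP x\<in>space M. \<Sum>k. survival (Suc k) x)"
  obtain c where c: "C = ennreal c" "c \<ge> 0"
    using assms unfolding C_def[symmetric] by (cases C) auto
  obtain n :: nat where "max (2 * c) 1 < n" using reals_Archimedean2 by blast
  then have n: "2 * c < n" "n \<ge> 1" by auto
  have "survival n x \<le> ennreal (1/2)" if x: "x \<in> space M" for x
  proof -
    obtain s where s: "survival n x = ennreal s" "s \<ge> 0"
      using survival_le_1[OF x, of n] by (cases "survival n x") (auto simp: top_unique)
    have "of_nat n * survival n x \<le> C"
      using of_nat_mult_survival_le[OF x] x unfolding C_def by (meson SUP_upper2)
    then have "real n * s \<le> c"
      using s c by (simp add: ennreal_of_nat_eq_real_of_nat ennreal_mult[symmetric])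
    then have "real n * s \<le> real n * (1/2)" using n by linarith
    then have "s \<le> 1/2" using n by (subst (asm) mult_le_cancel_left_pos) auto
    then show ?thesis unfolding s(1) by (rule ennreal_leI)
  qed
  then have "(SUP x\<in>space M. survival n x) \<le> ennreal (1/2)" by (rule SUP_least)
  also have "\<dots> < 1" by (subst ennreal_less_one_iff) simp
  finally show ?thesis using n by blast
qed

section \<open>Geometric drift functions and geometric decay of survival\<close>

text \<open>The bound \<open>1 \<le> W\<close> starts the induction, and each application of
  \<open>P\<close> to the induction hypothesis costs one more factor \<open>l\<close> by the drift
  inequality.\<close>

lemma survival_le_drift:
  fixes W :: "'a \<Rightarrow> real"
  assumes "W \<in> borel_measurable M" "\<forall>x\<in>space M. 1 \<le> W x" "0 < l"
    and drift: "\<forall>x\<in>space M. (\<integral>\<^sup>+y. ennreal (W y) \<partial>P x) \<le> ennreal (l * W x)"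
    and "x \<in> space M"
  shows "survival n x \<le> ennreal (l ^ n * W x)"
  using \<open>x \<in> space M\<close>
proof (induction n arbitrary: x)
  case 0
  then show ?case using assms(2) by (simp add: survival_0)
next
  case (Suc n)
  have W: "W \<in> borel_measurable (P x)"
    using assms(1) sets_kernel[OF Suc.prems] measurable_cong_sets by blast
  have "survival (Suc n) x \<le> (\<integral>\<^sup>+y. ennreal (l ^ n * W y) \<partial>P x)"
    unfolding survival_Suc[OF Suc.prems]
    using Suc by (intro nn_integral_mono) (auto simp: space_kernel)
  also have "\<dots> = (\<integral>\<^sup>+y. ennreal (l ^ n) * ennreal (W y) \<partial>P x)"
    using \<open>0 < l\<close> by (simp add: ennreal_mult')
  also have "\<dots> = ennreal (l ^ n) * (\<integral>\<^sup>+y. ennreal (W y) \<partial>P x)"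
    using W by (intro nn_integral_cmult) auto
  also have "\<dots> \<le> ennreal (l ^ n) * ennreal (l * W x)"
    using drift Suc.prems by (intro mult_left_mono) auto
  also have "\<dots> = ennreal (l ^ Suc n * W x)"
    using \<open>0 < l\<close> by (simp add: ennreal_mult'[symmetric] mult_ac)
  finally show ?case .
qed

lemma drift_imp_uniformly_geometric_transient:
  fixes W :: "'a \<Rightarrow> real"
  assumes W: "W \<in> borel_measurable M" "\<forall>x\<in>space M. 1 \<le> W x" "bounded (W ` space M)"
    and l: "0 < l" "l < 1"
    and drift: "\<forall>x\<in>space M. (\<integral>\<^sup>+y. ennreal (W y) \<partial>P x) \<le> ennreal (l * W x)"
  shows "uniformly_geometric_transient M P"
proof -
  \<comment> \<open>The decay rate is split as \<open>l = r * r\<close>: one factor pays for the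
    weight \<open>\<kappa> = 1/r > 1\<close>, the other is left as the ratio of a convergent
    geometric series.\<close>
  define r where "r = sqrt l"
  have r: "0 < r" "r < 1" "l = r * r" using l by (auto simp: r_def)
  obtain C where "\<And>x. x \<in> space M \<Longrightarrow> \<bar>W x\<bar> \<le> C"
    using W(3) unfolding bounded_iff by auto
  then have C: "W x \<le> C" if "x \<in> space M" for x
    using that abs_le_D1 by blast
  \<comment> \<open>The absolute value keeps the bound nonnegative even if \<open>space M\<close> is
    empty, when the sign of \<open>C\<close> is unknown.\<close>
  have "(\<Sum>n. ennreal ((1/r) ^ Suc n) * survival (Suc n) x) \<le> (\<Sum>n. ennreal (r ^ Suc n * \<bar>C\<bar>))"
    if x: "x \<in> space M" for x
  proof (rule suminf_le)
    fix n
    have "survival (Suc n) x \<le> ennreal (l ^ Suc n * W x)"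
      using survival_le_drift[OF W(1,2) l(1) drift x] .
    also have "\<dots> \<le> ennreal (l ^ Suc n * \<bar>C\<bar>)"
      using l C[OF x] by (intro ennreal_leI mult_left_mono) auto
    finally have "ennreal ((1/r) ^ Suc n) * survival (Suc n) x
        \<le> ennreal ((1/r) ^ Suc n) * ennreal (l ^ Suc n * \<bar>C\<bar>)"
      by (rule mult_left_mono) simp
    also have "\<dots> = ennreal (((1/r) * l) ^ Suc n * \<bar>C\<bar>)"
      using r by (simp only: ennreal_mult'[symmetric] power_mult_distrib mult.assoc)
        (subst ennreal_mult'[symmetric], auto simp: mult.assoc)
    also have "(1/r) * l = r" using r by simp
    finally show "ennreal ((1/r) ^ Suc n) * survival (Suc n) x \<le> ennreal (r ^ Suc n * \<bar>C\<bar>)" .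
  qed auto
  then have "(SUP x\<in>space M. \<Sum>n. ennreal ((1/r) ^ Suc n) * survival (Suc n) x)
      \<le> (\<Sum>n. ennreal (r ^ Suc n * \<bar>C\<bar>))"
    by (rule SUP_least)
  also have "\<dots> < \<infinity>"
  proof -
    have "summable (\<lambda>n. r ^ Suc n * \<bar>C\<bar>)"
      using r by (intro summable_mult2) (simp add: summable_geometric summable_mult)
    then show ?thesis using r by (subst suminf_ennreal2) auto
  qed
  finally show ?thesis
    unfolding uniformly_geometric_transient_def survival_def
    using r by (intro exI[of _ "1/r"]) auto
qed

text \<open>The witness is the sum of \<open>(1/l) ^ k * survival k\<close> over
  \<open>k < n\<close>. Applying \<open>P\<close> shifts the survival index by one, so apart from
  the factor \<open>l\<close> only the two end terms change, and \<open>l\<close> is chosen so that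
  the new end term is no larger than the lost one.\<close>

lemma survival_less_1_imp_drift:
  assumes "n \<ge> 1" and less: "(SUP x\<in>space M. survival n x) < 1"
  shows "\<exists>l::real. \<exists>W::'a \<Rightarrow> real. 0 < l \<and> l < 1 \<and>
    W \<in> borel_measurable M \<and> bounded (W ` space M) \<and> (\<forall>x\<in>space M. 1 \<le> W x) \<and>
    (\<forall>x\<in>space M. (\<integral>\<^sup>+y. ennreal (W y) \<partial>P x) \<le> ennreal (l * W x))"
proof -
  \<comment> \<open>Real-valued copies: \<open>W\<close> has to be real, and the index shift below
    subtracts a term.\<close>
  define s where "s k x = enn2real (survival k x)" for k x
  have s: "survival k x = ennreal (s k x)" "0 \<le> s k x" "s k x \<le> 1" if "x \<in> space M" for k x
  proof -
    have le: "survival k x \<le> 1" using that by (rule survival_le_1)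
    then have "survival k x < \<infinity>" by (metis ennreal_one_less_top infinity_ennreal_def order_le_less_trans)
    then show "survival k x = ennreal (s k x)" "0 \<le> s k x" by (auto simp: s_def)
    then show "s k x \<le> 1" using le by simp
  qed
  have s_0: "s 0 x = 1" if "x \<in> space M" for x
    using that by (simp add: s_def survival_0)
  obtain c0 where c0: "(SUP x\<in>space M. survival n x) = ennreal c0" "0 \<le> c0"
    using less by (cases "SUP x\<in>space M. survival n x") auto
  \<comment> \<open>The maximum keeps \<open>c\<close>, and hence its root, positive even when
    \<open>c0 = 0\<close>.\<close>
  define c where "c = max c0 (1/2)"
  have c: "0 < c" "c < 1" using c0 less by (auto simp: c_def ennreal_less_one_iff)
  have sc: "s n x \<le> c" if "x \<in> space M" for x
  proof -
    have "survival n x \<le> ennreal c0" using that unfolding c0(1)[symmetric] by (rule SUP_upper)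
    then show ?thesis using s(1)[OF that] c0(2) by (auto simp: c_def)
  qed
  \<comment> \<open>This makes \<open>(1/l) ^ n * c = 1\<close>, which is what balances the end
    terms.\<close>
  define l where "l = root n c"
  have l: "0 < l" "l < 1" "l ^ n = c" using c \<open>n \<ge> 1\<close> by (auto simp: l_def)
  define W where "W x = (\<Sum>k<n. (1/l) ^ k * s k x)" for x
  have W_measurable: "W \<in> borel_measurable M"
    unfolding W_def[abs_def] s_def[abs_def] by measurable
  have W_ge: "1 \<le> W x" if "x \<in> space M" for x
  proof -
    have "(\<Sum>k\<in>{0}. (1/l) ^ k * s k x) \<le> W x"
      unfolding W_def using \<open>n \<ge> 1\<close> l s(2)[OF that] by (intro sum_mono2) auto
    then show ?thesis using s_0[OF that] by simp
  qed
  have W_le: "W x \<le> (\<Sum>k<n. (1/l) ^ k)" if "x \<in> space M" for x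
    unfolding W_def using l s[OF that] by (intro sum_mono mult_left_le) auto
  have "bounded (W ` space M)"
    unfolding bounded_iff using W_ge W_le
    by (intro exI[of _ "\<Sum>k<n. (1/l) ^ k"]) (force simp: abs_of_nonneg)
  moreover have "(\<integral>\<^sup>+y. ennreal (W y) \<partial>P x) \<le> ennreal (l * W x)" if x: "x \<in> space M" for x
  proof -
    have "(\<integral>\<^sup>+y. ennreal (W y) \<partial>P x) = (\<integral>\<^sup>+y. (\<Sum>k<n. ennreal ((1/l) ^ k) * survival k y) \<partial>P x)"
    proof (rule nn_integral_cong)
      fix y assume "y \<in> space (P x)"
      then have y: "y \<in> space M" using x by (simp add: space_kernel)
      show "ennreal (W y) = (\<Sum>k<n. ennreal ((1/l) ^ k) * survival k y)"
        unfolding W_def using l s[OF y]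
        by (subst sum_ennreal[symmetric]) (auto simp: ennreal_mult' intro!: sum.cong)
    qed
    also have "\<dots> = (\<Sum>k<n. ennreal ((1/l) ^ k) * (\<integral>\<^sup>+y. survival k y \<partial>P x))"
      using borel_measurable_kernel[OF x survival_measurable]
      by (subst nn_integral_sum) (auto simp: nn_integral_cmult intro!: sum.cong)
    also have "\<dots> = (\<Sum>k<n. ennreal ((1/l) ^ k * s (Suc k) x))"
      using l s[OF x] by (simp add: survival_Suc[OF x, symmetric] ennreal_mult')
    also have "\<dots> = ennreal (\<Sum>k<n. (1/l) ^ k * s (Suc k) x)"
      using l s[OF x] by (intro sum_ennreal) auto
    also have "(\<Sum>k<n. (1/l) ^ k * s (Suc k) x) = l * (\<Sum>k<n. (1/l) ^ Suc k * s (Suc k) x)"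
      using l by (simp add: sum_distrib_left)
    \<comment> \<open>The shifted sum runs over the indices 1 to \<open>n\<close>: relative to
      \<open>W x\<close> it gains the term at \<open>n\<close> and loses the term at 0, which equals
      1.\<close>
    also have "(\<Sum>k<n. (1/l) ^ Suc k * s (Suc k) x) = W x + (1/l) ^ n * s n x - s 0 x"
      using sum.lessThan_Suc_shift[of "\<lambda>k. (1/l) ^ k * s k x" n]
      by (simp add: W_def algebra_simps)
    also have "ennreal (l * (W x + (1/l) ^ n * s n x - s 0 x)) \<le> ennreal (l * W x)"
    proof -
      have "(1/l) ^ n * s n x \<le> (1/l) ^ n * c"
        using l sc[OF x] by (intro mult_left_mono) auto
      also have "\<dots> = 1" using l c by (simp add: power_divide)
      finally show ?thesis using l s_0[OF x] by (intro ennreal_leI mult_left_mono) auto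
    qed
    finally show ?thesis .
  qed
  ultimately show ?thesis using l W_measurable W_ge by blast
qed

end

section \<open>Transition from the kernel to the killed chain\<close>

sublocale killed_markov_chain \<subseteq> substochastic_kernel
  by standard (rule kernel)

context killed_markov_chain
begin

lemma space_with_cemetery: "space (with_cemetery M) = insert None (Some ` space M)"
  unfolding with_cemetery_def by (rule space_measure_of) (auto dest: sets.sets_into_space)

lemma sets_with_cemetery:
  "sets (with_cemetery M) =
    sigma_sets (insert None (Some ` space M)) (insert {None} ((\<lambda>A. Some ` A) ` sets M))"
  unfolding with_cemetery_def by (rule sets_measure_of) (auto dest: sets.sets_into_space)

lemma None_sets_with_cemetery: "{None} \<in> sets (with_cemetery M)"
  unfolding sets_with_cemetery by (rule sigma_sets.Basic) simp

lemma Some_image_sets_with_cemetery: "A \<in> sets M \<Longrightarrow> Some ` A \<in> sets (with_cemetery M)"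
  unfolding sets_with_cemetery by (rule sigma_sets.Basic) simp

lemma measurable_with_cemetery:
  assumes "f \<in> M \<rightarrow>\<^sub>M N" "z \<in> space N"
  shows "(case_option z f) \<in> with_cemetery M \<rightarrow>\<^sub>M N"
proof (rule measurableI)
  fix A assume A: "A \<in> sets N"
  have "case_option z f -` A \<inter> space (with_cemetery M) =
      Some ` (f -` A \<inter> space M) \<union> (if z \<in> A then {None} else {})" (is "_ = ?R")
    by (auto simp: space_with_cemetery split: option.splits)
  moreover have "?R \<in> sets (with_cemetery M)"
    using None_sets_with_cemetery measurable_sets[OF assms(1) A]
    by (intro sets.Un Some_image_sets_with_cemetery) auto
  ultimately show "case_option z f -` A \<inter> space (with_cemetery M) \<in> sets (with_cemetery M)"
    by simp
qed (use assms in \<open>auto simp: space_with_cemetery dest: measurable_space\<close>)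

lemma space_Pr: "x \<in> space M \<Longrightarrow> space (Pr x) = space \<Omega>"
  by (rule sets_eq_imp_space_eq) (rule sets_Pr)

lemma measurable_chain_Pr: "x \<in> space M \<Longrightarrow> \<Phi> n \<in> Pr x \<rightarrow>\<^sub>M with_cemetery M"
  using measurable_chain sets_Pr measurable_cong_sets by blast

lemma space_in_history: "space \<Omega> \<in> history M \<Omega> \<Phi> n"
  unfolding history_def by (rule sigma_sets_top)

lemma borel_measurable_chain:
  "x \<in> space M \<Longrightarrow> f \<in> borel_measurable M \<Longrightarrow>
    (\<lambda>\<omega>. case_option (0::ennreal) f (\<Phi> n \<omega>)) \<in> borel_measurable (Pr x)"
  by (rule measurable_compose[OF measurable_chain_Pr measurable_with_cemetery]) auto

lemma chain_in_space:
  "x \<in> space M \<Longrightarrow> \<omega> \<in> space (Pr x) \<Longrightarrow> \<Phi> n \<omega> = Some y \<Longrightarrow> y \<in> space M"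
  using measurable_space[OF measurable_chain_Pr, of x \<omega> n] by (auto simp: space_with_cemetery)

text \<open>This extends the Markov property, used with \<open>B = space \<Omega>\<close>, from
  indicators to nonnegative measurable functions. Extension by 0 at the cemetery commutes with sums,
  multiples and increasing suprema, so the standard induction on measurable functions
  applies.\<close>

lemma nn_integral_chain_Suc:
  assumes f: "f \<in> borel_measurable M" and x: "x \<in> space M"
  shows "(\<integral>\<^sup>+\<omega>. case_option 0 f (\<Phi> (Suc n) \<omega>) \<partial>Pr x) =
    (\<integral>\<^sup>+\<omega>. case_option 0 (\<lambda>y. \<integral>\<^sup>+z. f z \<partial>P y) (\<Phi> n \<omega>) \<partial>Pr x)"
  using f
proof induction
  \<comment> \<open>Here \<open>f\<close> and \<open>g\<close> agree only on \<open>space M\<close>;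
    neither the chain while alive nor the measures \<open>P y\<close> see other points.\<close>
  case (cong f g)
  have "(\<integral>\<^sup>+\<omega>. case_option 0 f (\<Phi> (Suc n) \<omega>) \<partial>Pr x) = (\<integral>\<^sup>+\<omega>. case_option 0 g (\<Phi> (Suc n) \<omega>) \<partial>Pr x)"
    by (rule nn_integral_cong)
      (auto simp: cong.hyps dest: chain_in_space[OF x] split: option.splits)
  moreover have "(\<integral>\<^sup>+\<omega>. case_option 0 (\<lambda>y. \<integral>\<^sup>+z. f z \<partial>P y) (\<Phi> n \<omega>) \<partial>Pr x) =
      (\<integral>\<^sup>+\<omega>. case_option 0 (\<lambda>y. \<integral>\<^sup>+z. g z \<partial>P y) (\<Phi> n \<omega>) \<partial>Pr x)"
    by (rule nn_integral_cong)
      (auto simp: cong.hyps space_kernel dest: chain_in_space[OF x] intro!: nn_integral_cong split: option.splits)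
  ultimately show ?case using cong by simp
next
  case (set A)
  have "case_option 0 (indicator A) (\<Phi> (Suc n) \<omega>) =
      (indicator {\<omega> \<in> space \<Omega>. \<Phi> (Suc n) \<omega> \<in> Some ` A} \<omega> :: ennreal)" if "\<omega> \<in> space (Pr x)" for \<omega>
    using that x by (auto simp: space_Pr indicator_def split: option.splits)
  then have "(\<integral>\<^sup>+\<omega>. case_option 0 (indicator A) (\<Phi> (Suc n) \<omega>) \<partial>Pr x) =
      (\<integral>\<^sup>+\<omega>. indicator {\<omega> \<in> space \<Omega>. \<Phi> (Suc n) \<omega> \<in> Some ` A} \<omega> \<partial>Pr x)"
    by (rule nn_integral_cong)
  also have "\<dots> = emeasure (Pr x) {\<omega> \<in> space \<Omega>. \<Phi> (Suc n) \<omega> \<in> Some ` A}"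
    using measurable_sets[OF measurable_chain_Pr[OF x] Some_image_sets_with_cemetery[OF set], of "Suc n"] x
    by (intro nn_integral_indicator) (simp add: space_Pr vimage_def Int_def conj_commute)
  also have "\<dots> = (\<integral>\<^sup>+\<omega>\<in>space \<Omega>. (case \<Phi> n \<omega> of None \<Rightarrow> 0 | Some y \<Rightarrow> emeasure (P y) A) \<partial>Pr x)"
    by (subst markov[OF x set space_in_history, symmetric]) (auto intro!: arg_cong[where f="emeasure _"])
  also have "\<dots> = (\<integral>\<^sup>+\<omega>. case_option 0 (\<lambda>y. \<integral>\<^sup>+z. indicator A z \<partial>P y) (\<Phi> n \<omega>) \<partial>Pr x)"
  proof (rule nn_integral_cong)
    fix \<omega> assume \<omega>: "\<omega> \<in> space (Pr x)"
    have "(\<integral>\<^sup>+z. indicator A z \<partial>P y) = emeasure (P y) A" if "\<Phi> n \<omega> = Some y" for y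
      using measurable_space[OF measurable_chain_Pr[OF x] \<omega>, of n] that set
      by (auto simp: space_with_cemetery sets_kernel)
    then show "(case \<Phi> n \<omega> of None \<Rightarrow> 0 | Some y \<Rightarrow> emeasure (P y) A) * indicator (space \<Omega>) \<omega> =
        case_option 0 (\<lambda>y. \<integral>\<^sup>+z. indicator A z \<partial>P y) (\<Phi> n \<omega>)"
      using \<omega> x by (auto simp: space_Pr split: option.splits)
  qed
  finally show ?case .
next
  case (mult f c)
  have "case_option 0 (\<lambda>y. c * f y) t = c * case_option 0 f t" for t
    by (simp split: option.splits)
  then have "(\<integral>\<^sup>+\<omega>. case_option 0 (\<lambda>y. c * f y) (\<Phi> (Suc n) \<omega>) \<partial>Pr x) =
      c * (\<integral>\<^sup>+\<omega>. case_option 0 (\<lambda>y. \<integral>\<^sup>+z. f z \<partial>P y) (\<Phi> n \<omega>) \<partial>Pr x)"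
    using mult by (simp add: nn_integral_cmult borel_measurable_chain x)
  also have "\<dots> = (\<integral>\<^sup>+\<omega>. c * case_option 0 (\<lambda>y. \<integral>\<^sup>+z. f z \<partial>P y) (\<Phi> n \<omega>) \<partial>Pr x)"
    by (intro nn_integral_cmult[symmetric] borel_measurable_chain x borel_measurable_kernel_integral mult)
  also have "\<dots> = (\<integral>\<^sup>+\<omega>. case_option 0 (\<lambda>y. \<integral>\<^sup>+z. c * f z \<partial>P y) (\<Phi> n \<omega>) \<partial>Pr x)"
    by (rule nn_integral_cong) (auto simp: nn_integral_cmult borel_measurable_kernel mult.hyps
        dest: chain_in_space[OF x] split: option.splits)
  finally show ?case .
next
  case (add u v)
  have "case_option 0 (\<lambda>y. v y + u y) t = case_option 0 v t + case_option 0 u t" for t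
    by (simp split: option.splits)
  then have "(\<integral>\<^sup>+\<omega>. case_option 0 (\<lambda>y. v y + u y) (\<Phi> (Suc n) \<omega>) \<partial>Pr x) =
      (\<integral>\<^sup>+\<omega>. case_option 0 (\<lambda>y. \<integral>\<^sup>+z. v z \<partial>P y) (\<Phi> n \<omega>) \<partial>Pr x) +
      (\<integral>\<^sup>+\<omega>. case_option 0 (\<lambda>y. \<integral>\<^sup>+z. u z \<partial>P y) (\<Phi> n \<omega>) \<partial>Pr x)"
    using add by (simp add: nn_integral_add borel_measurable_chain x)
  also have "\<dots> = (\<integral>\<^sup>+\<omega>. case_option 0 (\<lambda>y. \<integral>\<^sup>+z. v z \<partial>P y) (\<Phi> n \<omega>) +
      case_option 0 (\<lambda>y. \<integral>\<^sup>+z. u z \<partial>P y) (\<Phi> n \<omega>) \<partial>Pr x)"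
    by (intro nn_integral_add[symmetric] borel_measurable_chain x borel_measurable_kernel_integral add)
  also have "\<dots> = (\<integral>\<^sup>+\<omega>. case_option 0 (\<lambda>y. \<integral>\<^sup>+z. v z + u z \<partial>P y) (\<Phi> n \<omega>) \<partial>Pr x)"
    by (rule nn_integral_cong) (auto simp: nn_integral_add borel_measurable_kernel add.hyps
        dest: chain_in_space[OF x] split: option.splits)
  finally show ?case .
next
  case (seq U)
  have inc: "incseq (\<lambda>i. case_option 0 (U i) t)" for t
    using seq by (auto simp: incseq_def le_fun_def split: option.splits)
  have "case_option 0 (SUP i. U i) t = (SUP i. case_option 0 (U i) t)" for t
    by (simp add: image_comp split: option.splits)
  then have "(\<integral>\<^sup>+\<omega>. case_option 0 (SUP i. U i) (\<Phi> (Suc n) \<omega>) \<partial>Pr x) =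
      (SUP i. \<integral>\<^sup>+\<omega>. case_option 0 (\<lambda>y. \<integral>\<^sup>+z. U i z \<partial>P y) (\<Phi> n \<omega>) \<partial>Pr x)"
    using seq inc
    by (simp add: nn_integral_monotone_convergence_SUP borel_measurable_chain x incseq_def le_fun_def)
  also have "\<dots> = (\<integral>\<^sup>+\<omega>. (SUP i. case_option 0 (\<lambda>y. \<integral>\<^sup>+z. U i z \<partial>P y) (\<Phi> n \<omega>)) \<partial>Pr x)"
    using seq
    by (intro nn_integral_monotone_convergence_SUP[symmetric] borel_measurable_chain x
        borel_measurable_kernel_integral seq)
      (auto simp: incseq_def le_fun_def intro!: nn_integral_mono split: option.splits)
  also have "\<dots> = (\<integral>\<^sup>+\<omega>. case_option 0 (\<lambda>y. \<integral>\<^sup>+z. (SUP i. U i) z \<partial>P y) (\<Phi> n \<omega>) \<partial>Pr x)"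
    by (rule nn_integral_cong) (auto simp: nn_integral_monotone_convergence_SUP[OF seq(3)]
        borel_measurable_kernel seq.hyps image_comp
        dest: chain_in_space[OF x] split: option.splits)
  finally show ?case .
qed

section \<open>Probability of being alive, and absence of return\<close>

text \<open>Leaving \<open>k\<close> arbitrary makes the induction work: a step of the chain is
  traded for a step of the kernel, lowering \<open>n\<close> and raising \<open>k\<close> by one,
  until the initial law evaluates the integrand at \<open>Some x\<close>.\<close>

lemma nn_integral_chain_survival:
  assumes x: "x \<in> space M"
  shows "(\<integral>\<^sup>+\<omega>. case_option 0 (survival k) (\<Phi> n \<omega>) \<partial>Pr x) = survival (n + k) x"
proof (induction n arbitrary: k)
  case 0
  have meas: "case_option 0 (survival k) \<in> borel_measurable (with_cemetery M)"
    by (rule measurable_with_cemetery) auto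
  have "(\<integral>\<^sup>+\<omega>. case_option 0 (survival k) (\<Phi> 0 \<omega>) \<partial>Pr x) =
      (\<integral>\<^sup>+t. case_option 0 (survival k) t \<partial>distr (Pr x) (with_cemetery M) (\<Phi> 0))"
    using meas by (intro nn_integral_distr[symmetric] measurable_chain_Pr x) auto
  also have "\<dots> = survival k x"
    unfolding initial[OF x] using meas x
    by (subst nn_integral_return) (auto simp: space_with_cemetery)
  finally show ?case by simp
next
  case (Suc n)
  have "(\<integral>\<^sup>+\<omega>. case_option 0 (survival k) (\<Phi> (Suc n) \<omega>) \<partial>Pr x) =
      (\<integral>\<^sup>+\<omega>. case_option 0 (survival (Suc k)) (\<Phi> n \<omega>) \<partial>Pr x)"
    unfolding nn_integral_chain_Suc[OF survival_measurable x]
    by (rule nn_integral_cong)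
      (auto simp: survival_Suc dest: chain_in_space[OF x] split: option.splits)
  then show ?case using Suc[of "Suc k"] by simp
qed

lemma alive_sets:
  "x \<in> space M \<Longrightarrow> {\<omega> \<in> space (Pr x). \<Phi> n \<omega> \<in> Some ` space M} \<in> sets (Pr x)"
  using measurable_sets[OF measurable_chain_Pr Some_image_sets_with_cemetery[OF sets.top]]
  by (simp add: vimage_def Int_def conj_commute)

text \<open>Case \<open>k = 0\<close> of the preceding lemma: \<open>survival 0\<close> is 1 on the
  state space, so its extension by 0 is the indicator of being alive.\<close>

lemma emeasure_alive:
  assumes x: "x \<in> space M"
  shows "emeasure (Pr x) {\<omega> \<in> space (Pr x). \<Phi> n \<omega> \<in> Some ` space M} = survival n x"
proof -
  have "emeasure (Pr x) {\<omega> \<in> space (Pr x). \<Phi> n \<omega> \<in> Some ` space M} =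
      (\<integral>\<^sup>+\<omega>. indicator {\<omega> \<in> space (Pr x). \<Phi> n \<omega> \<in> Some ` space M} \<omega> \<partial>Pr x)"
    using alive_sets[OF x] by simp
  also have "\<dots> = (\<integral>\<^sup>+\<omega>. case_option 0 (survival 0) (\<Phi> n \<omega>) \<partial>Pr x)"
    by (rule nn_integral_cong)
      (auto simp: survival_0 indicator_def dest: chain_in_space[OF x] split: option.splits)
  finally show ?thesis using nn_integral_chain_survival[OF x] by simp
qed

lemma AE_initially_alive:
  assumes x: "x \<in> space M"
  shows "AE \<omega> in Pr x. \<Phi> 0 \<omega> \<in> Some ` space M"
proof -
  interpret prob_space "Pr x" using x by (rule prob_space_Pr)
  show ?thesis
    using emeasure_alive[OF x, of 0] alive_sets[OF x, of 0] x
    by (intro AE_I_eq_1) (auto simp: survival_0)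
qed

text \<open>The Markov property is applied to the event \<open>B\<close> that the chain is in the
  cemetery at time \<open>n\<close>, where the conditional probability of being alive next is
  0.\<close>

lemma AE_no_return:
  assumes x: "x \<in> space M"
  shows "AE \<omega> in Pr x. \<Phi> (Suc n) \<omega> \<in> Some ` space M \<longrightarrow> \<Phi> n \<omega> \<in> Some ` space M"
proof -
  define B where "B = \<Phi> n -` {None} \<inter> space \<Omega>"
  have B: "B \<in> history M \<Omega> \<Phi> n"
    unfolding history_def B_def using None_sets_with_cemetery by (intro sigma_sets.Basic) blast
  have "{\<omega> \<in> space (Pr x). \<not> (\<Phi> (Suc n) \<omega> \<in> Some ` space M \<longrightarrow> \<Phi> n \<omega> \<in> Some ` space M)} =
      B \<inter> {\<omega> \<in> space \<Omega>. \<Phi> (Suc n) \<omega> \<in> Some ` space M}"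
    using measurable_space[OF measurable_chain, of _ n] x
    by (fastforce simp: B_def space_Pr space_with_cemetery)
  moreover have "emeasure (Pr x) (B \<inter> {\<omega> \<in> space \<Omega>. \<Phi> (Suc n) \<omega> \<in> Some ` space M}) = 0"
    unfolding markov[OF x sets.top B]
    by (rule nn_integral_zero') (auto simp: B_def indicator_def)
  moreover have "B \<inter> {\<omega> \<in> space \<Omega>. \<Phi> (Suc n) \<omega> \<in> Some ` space M} \<in> sets (Pr x)"
    using measurable_sets[OF measurable_chain_Pr[OF x] None_sets_with_cemetery, of n]
      alive_sets[OF x, of "Suc n"] x by (auto simp: B_def space_Pr)
  ultimately show ?thesis by (intro AE_I[OF equalityD1]) auto
qed

section \<open>The last time alive and its moments\<close>

text \<open>The times at which a path is alive are nonempty and downward closed; when their supremum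
  is finite it is attained, and they form an initial segment of the naturals.\<close>

lemma last_time_eq:
  assumes zero: "\<Phi> 0 \<omega> \<in> Some ` space M"
    and down: "\<And>n. \<Phi> (Suc n) \<omega> \<in> Some ` space M \<Longrightarrow> \<Phi> n \<omega> \<in> Some ` space M"
    and fin: "last_time M \<Phi> \<omega> < \<infinity>"
  obtains t where "last_time M \<Phi> \<omega> = enat t" "\<And>n. \<Phi> n \<omega> \<in> Some ` space M \<longleftrightarrow> n \<le> t"
proof -
  define D where "D = {n. \<Phi> n \<omega> \<in> Some ` space M}"
  obtain t where t: "last_time M \<Phi> \<omega> = enat t" using fin by auto
  have le: "n \<le> t" if "n \<in> D" for n
    using SUP_upper[OF that, of enat] t by (simp add: last_time_def D_def)
  then have "finite D" by (meson finite_nat_set_iff_bounded_le)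
  have "0 \<in> D" using zero by (simp add: D_def)
  have "last_time M \<Phi> \<omega> \<le> enat (Max D)"
    unfolding last_time_def using Max_ge[OF \<open>finite D\<close>] by (intro SUP_least) (auto simp: D_def)
  then have "t = Max D" using t le Max_in[OF \<open>finite D\<close>] \<open>0 \<in> D\<close>
    by (auto intro!: antisym)
  then have "t \<in> D" using Max_in[OF \<open>finite D\<close>] \<open>0 \<in> D\<close> by auto
  have "n \<in> D" if "n \<le> t" for n
    using that \<open>t \<in> D\<close> by (induction rule: inc_induct) (auto simp: D_def intro: down)
  with le show thesis by (intro that[OF t]) (auto simp: D_def)
qed

lemma AE_last_time:
  assumes x: "x \<in> space M"
    and fin: "measure (Pr x) {\<omega> \<in> space (Pr x). last_time M \<Phi> \<omega> < \<infinity>} = 1"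
  shows "AE \<omega> in Pr x. \<exists>t. last_time M \<Phi> \<omega> = enat t \<and> (\<forall>n. \<Phi> n \<omega> \<in> Some ` space M \<longleftrightarrow> n \<le> t)"
proof -
  interpret prob_space "Pr x" using x by (rule prob_space_Pr)
  \<comment> \<open>\<open>measure\<close> takes the value 0 outside the sigma-algebra, so the value
    1 already forces measurability.\<close>
  have "{\<omega> \<in> space (Pr x). last_time M \<Phi> \<omega> < \<infinity>} \<in> events"
    using fin measure_notin_sets by fastforce
  then have "AE \<omega> in Pr x. last_time M \<Phi> \<omega> < \<infinity>"
    using fin by (intro AE_I_eq_1) (auto simp: emeasure_eq_measure)
  moreover have "AE \<omega> in Pr x. \<forall>n. \<Phi> (Suc n) \<omega> \<in> Some ` space M \<longrightarrow> \<Phi> n \<omega> \<in> Some ` space M"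
    using AE_no_return[OF x] by (simp add: AE_all_countable)
  ultimately show ?thesis
    using AE_initially_alive[OF x]
  proof eventually_elim
    case (elim \<omega>)
    then show ?case by (metis last_time_eq)
  qed
qed

text \<open>Summation by parts: a weight \<open>g\<close> with increments \<open>h\<close> satisfies
  \<open>g \<tau> = g 0 + (\<Sum>n<\<tau>. h n)\<close>, and \<open>n < \<tau>\<close> means that the chain is alive at time \<open>n + 1\<close>.\<close>

lemma nn_integral_last_time:
  fixes g :: "enat \<Rightarrow> ennreal"
  assumes x: "x \<in> space M"
    and fin: "measure (Pr x) {\<omega> \<in> space (Pr x). last_time M \<Phi> \<omega> < \<infinity>} = 1"
    and g: "\<And>t. g (enat t) = g 0 + (\<Sum>n<t. h n)"
  shows "(\<integral>\<^sup>+\<omega>. g (last_time M \<Phi> \<omega>) \<partial>Pr x) = g 0 + (\<Sum>n. h n * survival (Suc n) x)"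
proof -
  interpret prob_space "Pr x" using x by (rule prob_space_Pr)
  define A where "A n = {\<omega> \<in> space (Pr x). \<Phi> (Suc n) \<omega> \<in> Some ` space M}" for n
  have A [measurable]: "A n \<in> events" for n unfolding A_def by (rule alive_sets[OF x])
  have "AE \<omega> in Pr x. g (last_time M \<Phi> \<omega>) = g 0 + (\<Sum>n. h n * indicator (A n) \<omega>)"
    using AE_last_time[OF x fin] AE_space
  proof eventually_elim
    case (elim \<omega>)
    then obtain t where t: "last_time M \<Phi> \<omega> = enat t"
      "\<And>n. \<Phi> n \<omega> \<in> Some ` space M \<longleftrightarrow> n \<le> t" by blast
    \<comment> \<open>\<open>A n\<close> refers to time \<open>Suc n\<close>, so it holds exactly
      when \<open>Suc n \<le> t\<close>, that is, \<open>n < t\<close>.\<close>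
    have ind: "indicator (A n) \<omega> = (if n < t then 1 else 0 :: ennreal)" for n
      using t(2)[of "Suc n"] elim by (auto simp: A_def indicator_def)
    have "(\<Sum>n. h n * indicator (A n) \<omega>) = (\<Sum>n<t. h n * indicator (A n) \<omega>)"
      by (rule suminf_finite) (auto simp: ind)
    also have "\<dots> = (\<Sum>n<t. h n)" by (simp add: ind)
    finally show ?case using t(1) g by simp
  qed
  \<comment> \<open>The integrand is replaced almost everywhere by a series of indicators of
    measurable events, which can be integrated term by term.\<close>
  then have "(\<integral>\<^sup>+\<omega>. g (last_time M \<Phi> \<omega>) \<partial>Pr x) =
      (\<integral>\<^sup>+\<omega>. g 0 + (\<Sum>n. h n * indicator (A n) \<omega>) \<partial>Pr x)"
    by (rule nn_integral_cong_AE)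
  also have "\<dots> = g 0 + (\<Sum>n. h n * emeasure (Pr x) (A n))"
    by (simp add: nn_integral_add nn_integral_suminf nn_integral_cmult emeasure_space_1)
  also have "\<dots> = g 0 + (\<Sum>n. h n * survival (Suc n) x)"
    by (simp only: A_def emeasure_alive[OF x])
  finally show ?thesis .
qed

text \<open>The increment of \<open>\<kappa> ^ n\<close> is
  \<open>(\<kappa> - 1) / \<kappa> * \<kappa> ^ Suc n\<close>, written in this form to match the
  weights in the definition of uniform geometric transience.\<close>

lemma nn_integral_pow_last_time:
  assumes "x \<in> space M"
    and "measure (Pr x) {\<omega> \<in> space (Pr x). last_time M \<Phi> \<omega> < \<infinity>} = 1"
    and "1 < \<kappa>"
  shows "(\<integral>\<^sup>+\<omega>. pow_enat \<kappa> (last_time M \<Phi> \<omega>) \<partial>Pr x) =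
    1 + ennreal ((\<kappa> - 1) / \<kappa>) * (\<Sum>n. ennreal (\<kappa> ^ Suc n) * survival (Suc n) x)"
proof -
  have "pow_enat \<kappa> (enat t) = pow_enat \<kappa> 0 + (\<Sum>n<t. ennreal ((\<kappa> - 1) / \<kappa> * \<kappa> ^ Suc n))" for t
  proof -
    have "\<kappa> ^ t = 1 + (\<Sum>n<t. (\<kappa> - 1) / \<kappa> * \<kappa> ^ Suc n)"
      using \<open>1 < \<kappa>\<close> by (induction t) (auto simp: field_simps)
    moreover have "0 \<le> (\<Sum>n<t. (\<kappa> - 1) / \<kappa> * \<kappa> ^ Suc n)"
      using \<open>1 < \<kappa>\<close> by (intro sum_nonneg) auto
    ultimately have "ennreal (\<kappa> ^ t) = 1 + ennreal (\<Sum>n<t. (\<kappa> - 1) / \<kappa> * \<kappa> ^ Suc n)"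
      by (metis ennreal_1 ennreal_plus zero_le_one)
    then show ?thesis
      using \<open>1 < \<kappa>\<close> by (subst sum_ennreal) (auto simp: pow_enat_def zero_enat_def)
  qed
  from nn_integral_last_time[OF assms(1,2) this]
  have "(\<integral>\<^sup>+\<omega>. pow_enat \<kappa> (last_time M \<Phi> \<omega>) \<partial>Pr x) =
      1 + (\<Sum>n. ennreal ((\<kappa> - 1) / \<kappa> * \<kappa> ^ Suc n) * survival (Suc n) x)"
    by (simp add: pow_enat_def zero_enat_def)
  also have "(\<lambda>n. ennreal ((\<kappa> - 1) / \<kappa> * \<kappa> ^ Suc n) * survival (Suc n) x) =
      (\<lambda>n. ennreal ((\<kappa> - 1) / \<kappa>) * (ennreal (\<kappa> ^ Suc n) * survival (Suc n) x))"
    using \<open>1 < \<kappa>\<close> by (intro ext, subst ennreal_mult) (auto simp: mult.assoc)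
  finally show ?thesis by simp
qed

lemma nn_integral_of_enat_last_time:
  assumes "x \<in> space M"
    and "measure (Pr x) {\<omega> \<in> space (Pr x). last_time M \<Phi> \<omega> < \<infinity>} = 1"
  shows "(\<integral>\<^sup>+\<omega>. ennreal_of_enat (last_time M \<Phi> \<omega>) \<partial>Pr x) = (\<Sum>n. survival (Suc n) x)"
  using nn_integral_last_time[OF assms, of ennreal_of_enat "\<lambda>_. 1"]
  by (simp add: zero_enat_def)

end

theorem theorem2p15:
  fixes M :: "'a measure" and P :: "'a \<Rightarrow> 'a measure" and \<psi> :: "'a measure"
    and \<Omega> :: "'w measure" and Pr :: "'a \<Rightarrow> 'w measure" and \<Phi> :: "nat \<Rightarrow> 'w \<Rightarrow> 'a option"
  assumes "countably_generated M"
    and "killed_markov_chain M P \<Omega> Pr \<Phi>"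
    and "maximal_irreducibility_measure M P \<psi>"
    and "\<And>x. x \<in> space M \<Longrightarrow>
      measure (Pr x) {\<omega> \<in> space (Pr x). last_time M \<Phi> \<omega> < \<infinity>} = 1"
  shows "(uniformly_geometric_transient M P \<longleftrightarrow>
            (\<exists>\<kappa>>1. (SUP x\<in>space M. \<integral>\<^sup>+\<omega>. pow_enat \<kappa> (last_time M \<Phi> \<omega>) \<partial>Pr x) < \<infinity>)) \<and>
         (uniformly_geometric_transient M P \<longleftrightarrow>
            (\<exists>l::real. \<exists>W::'a \<Rightarrow> real. 0 < l \<and> l < 1 \<and>
               W \<in> borel_measurable M \<and> bounded (W ` space M) \<and> (\<forall>x\<in>space M. 1 \<le> W x) \<and>
               (\<forall>x\<in>space M. (\<integral>\<^sup>+y. ennreal (W y) \<partial>P x) \<le> ennreal (l * W x)))) \<and>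
         (uniformly_geometric_transient M P \<longleftrightarrow>
            (\<exists>n0\<ge>1. (SUP x\<in>space M. emeasure (kernel_pow M P n0 x) (space M)) < 1)) \<and>
         (uniformly_geometric_transient M P \<longleftrightarrow>
            (SUP x\<in>space M. \<integral>\<^sup>+\<omega>. ennreal_of_enat (last_time M \<Phi> \<omega>) \<partial>Pr x) < \<infinity>)"
proof -
  interpret killed_markov_chain M P \<Omega> Pr \<Phi> by (rule assms(2))
  let ?S = "\<lambda>\<kappa> x. \<Sum>n. ennreal (\<kappa> ^ Suc n) * survival (Suc n) x"
  let ?E = "\<lambda>\<kappa> x. \<integral>\<^sup>+\<omega>. pow_enat \<kappa> (last_time M \<Phi> \<omega>) \<partial>Pr x"
  have ugt: "uniformly_geometric_transient M P \<longleftrightarrow> (\<exists>\<kappa>>1. (SUP x\<in>space M. ?S \<kappa> x) < \<infinity>)"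
    by (simp only: uniformly_geometric_transient_def survival_def)
  \<comment> \<open>The equivalence holds for each \<open>\<kappa>\<close> separately, since
    \<open>?E\<close> is an affine function of \<open>?S\<close> with finite positive slope
    \<open>a\<close>; its inverse \<open>b\<close> bounds \<open>?S\<close> by \<open>?E\<close> in
    turn.\<close>
  have "(SUP x\<in>space M. ?S \<kappa> x) < \<infinity> \<longleftrightarrow> (SUP x\<in>space M. ?E \<kappa> x) < \<infinity>" if "1 < \<kappa>" for \<kappa>
  proof -
    define a where "a = ennreal ((\<kappa> - 1) / \<kappa>)"
    define b where "b = ennreal (\<kappa> / (\<kappa> - 1))"
    have ab: "b * a = 1"
      using that by (simp add: a_def b_def ennreal_mult'[symmetric])
    have E: "?E \<kappa> x = 1 + a * ?S \<kappa> x" if x: "x \<in> space M" for x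
      unfolding a_def by (rule nn_integral_pow_last_time[OF x assms(4)[OF x] \<open>1 < \<kappa>\<close>])
    have "(SUP x\<in>space M. ?E \<kappa> x) \<le> 1 + a * (SUP x\<in>space M. ?S \<kappa> x)"
      by (rule SUP_least) (auto simp only: E intro!: add_left_mono mult_left_mono SUP_upper zero_le)
    moreover have "(SUP x\<in>space M. ?S \<kappa> x) \<le> b * (SUP x\<in>space M. ?E \<kappa> x)"
    proof (rule SUP_least)
      fix x assume x: "x \<in> space M"
      have "?S \<kappa> x = b * (a * ?S \<kappa> x)" by (simp only: mult.assoc[symmetric] ab mult_1)
      also have "\<dots> \<le> b * ?E \<kappa> x" unfolding E[OF x] by (rule mult_left_mono) auto
      also have "\<dots> \<le> b * (SUP x\<in>space M. ?E \<kappa> x)" using x by (intro mult_left_mono SUP_upper) auto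
      finally show "?S \<kappa> x \<le> b * (SUP x\<in>space M. ?E \<kappa> x)" .
    qed
    moreover have "1 + a * s < \<infinity>" "b * s < \<infinity>" if "s < \<infinity>" for s
      using that by (auto simp: a_def b_def ennreal_mult_less_top)
    ultimately show ?thesis by (meson order_le_less_trans)
  qed
  then have one_two: "uniformly_geometric_transient M P \<longleftrightarrow>
      (\<exists>\<kappa>>1. (SUP x\<in>space M. ?E \<kappa> x) < \<infinity>)"
    unfolding ugt by blast
  have five: "(SUP x\<in>space M. \<integral>\<^sup>+\<omega>. ennreal_of_enat (last_time M \<Phi> \<omega>) \<partial>Pr x) =
      (SUP x\<in>space M. \<Sum>n. survival (Suc n) x)"
    by (intro SUP_cong refl nn_integral_of_enat_last_time assms(4))
  have one_five: "(SUP x\<in>space M. \<Sum>n. survival (Suc n) x) < \<infinity>" if "uniformly_geometric_transient M P"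
  proof -
    from that obtain \<kappa> where \<kappa>: "\<kappa> > 1" "(SUP x\<in>space M. ?S \<kappa> x) < \<infinity>" unfolding ugt by blast
    \<comment> \<open>The weights are at least 1, so dropping them can only decrease the
      sum.\<close>
    have "survival (Suc n) x \<le> ennreal (\<kappa> ^ Suc n) * survival (Suc n) x" for n x
    proof -
      have "1 \<le> ennreal (\<kappa> ^ Suc n)" using \<kappa>(1) one_le_power[of \<kappa> "Suc n"] by simp
      from mult_right_mono[OF this] show ?thesis by fastforce
    qed
    then have "(SUP x\<in>space M. \<Sum>n. survival (Suc n) x) \<le> (SUP x\<in>space M. ?S \<kappa> x)"
      by (intro SUP_mono' suminf_le) auto
    then show ?thesis using \<kappa>(2) by (rule order_le_less_trans)
  qed
  have five_four: "\<exists>n\<ge>1. (SUP x\<in>space M. emeasure (kernel_pow M P n x) (space M)) < 1"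
    if "(SUP x\<in>space M. \<Sum>n. survival (Suc n) x) < \<infinity>"
    using ex_survival_less_1[OF that] by (simp only: survival_def)
  note four_three = survival_less_1_imp_drift[unfolded survival_def]
  note three_one = drift_imp_uniformly_geometric_transient
  \<comment> \<open>(1) and (2) are matched directly; the others close the cycle (1), (5), (4), (3),
    (1).\<close>
  show ?thesis
    unfolding five
    by (intro conjI one_two) (use one_five five_four four_three three_one in blast)+
qed

end
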